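(* Let $G$ be a digraph on $n$ vertices satisfying one of the following: (A) $n\ge 2$, $G$ has no double arcs, and $G$ has exactly one loop; (B) $|E(G)|\le 2n-2$ and the underlying simple graph of $G$ is a tree. Then $G$ does not allow the nSSP.
   Context: A digraph $G$ has vertex set $[n]$ and arc set $E(G)\subseteq[n]\times[n]$; arcs $(v,v)$ are loops and count as arcs in $|E(G)|$. A double arc is a pair $(u,v),(v,u)\in E(G)$ with $u\ne v$. The underlying simple graph of $G$ is the undirected graph on $[n]$ with an edge $uv$ ($u\ne v$) whenever $(u,v)$ or $(v,u)$ is an arc. $\mathcal M(G)$ is the set of real $n\times n$ matrices $A=(a_{ij})$ with $a_{ij}\ne0$ iff $(i,j)\in E(G)$. A real matrix $A$ has the nSSP if the only real $X$ with $A\circ X=O$ (entrywise product) and $AX^\top-X^\top A=O$ is $X=O$. $G$ allows the nSSP if some $A\in\mathcal M(G)$ has the nSSP. *)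

theory Defs
  imports "Graph_Theory.Digraph_Component" "Jordan_Normal_Form.Matrix"
begin

text \<open>A digraph on the vertex set [n] is a well-formed \<^typ>\<open>nat pair_pre_digraph\<close> with vertex
  set \<open>{0..<n}\<close>; vertices are numbered from 0 so that they are the row and column indices of a matrix.\<close>

definition digraph_on :: "nat \<Rightarrow> nat pair_pre_digraph \<Rightarrow> bool" where
  "digraph_on n G \<longleftrightarrow> pair_wf_digraph G \<and> pverts G = {0..<n}"

definition has_double_arc :: "'a pair_pre_digraph \<Rightarrow> bool" where
  "has_double_arc G \<longleftrightarrow> (\<exists>u v. u \<noteq> v \<and> (u, v) \<in> parcs G \<and> (v, u) \<in> parcs G)"

text \<open>As usual in this library, an undirected simple graph is a symmetric loop-free digraph
  (\<^locale>\<open>pair_graph\<close>), each edge being represented by two opposite arcs.\<close>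

definition underlying_simple_graph :: "'a pair_pre_digraph \<Rightarrow> 'a pair_pre_digraph" where
  "underlying_simple_graph G =
     \<lparr> pverts = pverts G,
       parcs = {(u, v). u \<noteq> v \<and> ((u, v) \<in> parcs G \<or> (v, u) \<in> parcs G)} \<rparr>"

lemma pair_graph_underlying_simple_graph:
  assumes "digraph_on n G"
  shows "pair_graph (underlying_simple_graph G)"
proof -
  from assms interpret pair_wf_digraph G by (simp add: digraph_on_def)
  have V: "finite (pverts G)" using assms by (simp add: digraph_on_def)
  have "parcs (underlying_simple_graph G) \<subseteq> pverts G \<times> pverts G"
    by (auto simp: underlying_simple_graph_def dest: wellformed')
  then have "finite (parcs (underlying_simple_graph G))"
    by (rule finite_subset) (simp add: V)
  then show ?thesis
    using V by unfold_locales
      (auto simp: underlying_simple_graph_def symmetric_def intro!: symI dest: wellformed')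
qed

text \<open>The constant \<^const>\<open>tree\<close> cannot be used for the symmetric representation: it forbids every
  directed cycle, including the walk along an edge and back. A cycle of the undirected graph is a
  directed cycle (with pairwise distinct vertices) of length at least 3.
  \<^const>\<open>connected\<close> includes that there is at least one vertex.\<close>

definition undirected_tree :: "'a pair_pre_digraph \<Rightarrow> bool" where
  "undirected_tree H \<longleftrightarrow>
     connected (with_proj H) \<and>
     \<not> (\<exists>p. pre_digraph.cycle (with_proj H) p \<and> 3 \<le> length p)"

definition matrices_of :: "nat pair_pre_digraph \<Rightarrow> real mat set" where
  "matrices_of G =
     {A \<in> carrier_mat (card (pverts G)) (card (pverts G)).
        \<forall>i \<in> pverts G. \<forall>j \<in> pverts G. A $$ (i, j) \<noteq> 0 \<longleftrightarrow> (i, j) \<in> parcs G}"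

definition hadamard :: "'a :: times mat \<Rightarrow> 'a mat \<Rightarrow> 'a mat" where
  "hadamard A B = mat (dim_row A) (dim_col A) (\<lambda>(i, j). A $$ (i, j) * B $$ (i, j))"

definition has_nSSP :: "real mat \<Rightarrow> bool" where
  "has_nSSP A \<longleftrightarrow> square_mat A \<and>
     (let n = dim_row A in
       \<forall>X \<in> carrier_mat n n.
         hadamard A X = 0\<^sub>m n n \<and>
         A * transpose_mat X - transpose_mat X * A = 0\<^sub>m n n \<longrightarrow> X = 0\<^sub>m n n)"

definition allows_nSSP :: "nat pair_pre_digraph \<Rightarrow> bool" where
  "allows_nSSP G \<longleftrightarrow> (\<exists>A \<in> matrices_of G. has_nSSP A)"

end

theory Submission
  imports Defs "Jordan_Normal_Form.Schur_Decomposition"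
begin

text \<open>The matrix \<open>X\<close> violating the nSSP is found as the transpose of a nonzero \<open>Y\<close> commuting with
  \<open>A\<close> such that \<open>Y\<^sub>j\<^sub>i = 0\<close> for every arc \<open>(i, j)\<close>. In case (A) subtract from \<open>A\<close> the scalar matrix
  of its only nonzero diagonal entry. In case (B) the numbers
  \<open>A\<^sub>u\<^sub>w Y\<^sub>w\<^sub>u - A\<^sub>w\<^sub>u Y\<^sub>u\<^sub>w\<close> form a circulation on the underlying tree, by comparing the
  diagonals of \<open>A Y\<close> and \<open>Y A\<close>, hence they vanish. Therefore one of the conditions belonging to
  each edge of the tree is redundant, and at most \<open>(2n - 2) - (n - 1) = n - 1\<close> linear
  conditions remain on the centralizer of \<open>A\<close>, whose dimension is at least \<open>n\<close>.\<close>

section \<open>Underdetermined homogeneous linear systems\<close>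

text \<open>Gaussian elimination, by induction on the equations: if equation \<open>e\<close> has a
  nonzero coefficient at some unknown \<open>t\<close>, it is solved for \<open>t\<close>.
  Substituting into the others leaves one equation and one unknown fewer.\<close>

lemma homogeneous_system_nontrivial:
  fixes c :: "'e \<Rightarrow> 's \<Rightarrow> 'a::field"
  assumes "finite E" "finite S" "card E < card S"
  shows "\<exists>x. (\<exists>s\<in>S. x s \<noteq> 0) \<and> (\<forall>e\<in>E. (\<Sum>s\<in>S. c e s * x s) = 0)"
  using assms
proof (induction E arbitrary: S c rule: finite_induct)
  case empty
  then obtain s where "s \<in> S" by fastforce
  then show ?case by (intro exI[of _ "\<lambda>_. 1"]) auto
next
  case (insert e E)
  have card: "Suc (card E) < card S" using insert by simp
  show ?case
  proof (cases "\<exists>t\<in>S. c e t \<noteq> 0")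
    case False
    obtain x where "\<exists>s\<in>S. x s \<noteq> 0" "\<forall>e\<in>E. (\<Sum>s\<in>S. c e s * x s) = 0"
      using insert.IH[OF insert.prems(1), of c] card by auto
    then show ?thesis using False by (intro exI[of _ x]) auto
  next
    case True
    then obtain t where t: "t \<in> S" "c e t \<noteq> 0" by blast
    define S' where "S' = S - {t}"
    have S': "finite S'" "t \<notin> S'" "S = insert t S'" "card E < card S'"
      using t insert.prems card by (auto simp: S'_def)
    obtain x where x: "\<exists>s\<in>S'. x s \<noteq> 0"
      "\<forall>e'\<in>E. (\<Sum>s\<in>S'. (c e' s - c e' t * c e s / c e t) * x s) = 0"
      using insert.IH[OF S'(1,4), of "\<lambda>e' s. c e' s - c e' t * c e s / c e t"] by blast
    \<comment> \<open>The value at \<open>t\<close> is the one that equation \<open>e\<close>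
      forces.\<close>
    define y where "y = x(t := - (\<Sum>s\<in>S'. c e s * x s) / c e t)"
    have sumy: "(\<Sum>s\<in>S. c e' s * y s)
        = (\<Sum>s\<in>S'. c e' s * x s) - c e' t * (\<Sum>s\<in>S'. c e s * x s) / c e t" for e'
    proof -
      have "(\<Sum>s\<in>S'. c e' s * y s) = (\<Sum>s\<in>S'. c e' s * x s)"
        using S'(2) by (intro sum.cong) (auto simp: y_def)
      then show ?thesis using S' by (simp add: y_def)
    qed
    have "(\<Sum>s\<in>S. c e' s * y s) = 0" if "e' \<in> insert e E" for e'
    proof (cases "e' = e")
      case True
      then show ?thesis using sumy[of e] t by simp
    next
      case False
      then have "(\<Sum>s\<in>S'. (c e' s - c e' t * c e s / c e t) * x s) = 0" using x(2) that by auto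
      then show ?thesis
        unfolding sumy
        by (simp add: left_diff_distrib sum_subtractf sum_distrib_left sum_divide_distrib mult.assoc)
    qed
    moreover have "\<exists>s\<in>S. y s \<noteq> 0" using x(1) S' by (auto simp: y_def)
    ultimately show ?thesis by blast
  qed
qed

section \<open>Commuting matrices with prescribed zeros\<close>

text \<open>The two sets differ by the diagonal. They index the commutator equations and the
  unknowns of an upper triangular matrix, so \<open>n\<close> degrees of freedom remain.\<close>

lemma card_strict_upper_add:
  "card {(k, l). k < l \<and> l < (n::nat)} + n = card {(k, l). k \<le> l \<and> l < n}"
proof -
  have eq: "{(k, l). k \<le> l \<and> l < n} = {(k, l). k < l \<and> l < n} \<union> (\<lambda>i. (i, i)) ` {..<n}"
    by auto
  have fin: "finite {(k, l). k < l \<and> l < n}"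
    by (rule finite_subset[of _ "{..<n} \<times> {..<n}"]) auto
  have diag: "card ((\<lambda>i. (i, i)) ` {..<n}) = n"
    by (subst card_image) (auto simp: inj_on_def)
  show ?thesis
    unfolding eq using fin diag by (subst card_Un_disjoint) auto
qed

text \<open>The dimension of the centralizer is at least \<open>n\<close>: for an upper triangular matrix \<open>T\<close>, the
  commutator with \<open>T\<close> maps the upper triangular matrices to the strictly upper triangular
  ones, a space whose dimension is smaller by \<open>n\<close>.\<close>

lemma complex_commuting_matrix_exists:
  fixes A :: "complex mat"
  assumes A: "A \<in> carrier_mat n n" and C: "C \<subseteq> {..<n} \<times> {..<n}" "card C < n"
  shows "\<exists>Y \<in> carrier_mat n n. Y \<noteq> 0\<^sub>m n n \<and> A * Y = Y * A \<and> (\<forall>(i, j)\<in>C. Y $$ (i, j) = 0)"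
proof -
  obtain es where "char_poly A = (\<Prod>a\<leftarrow>es. [:- a, 1:])"
    using char_poly_factorized[OF A] by blast
  then obtain T where "T \<in> carrier_mat n n" and upT: "upper_triangular T" and "similar_mat A T"
    using schur_decomposition_exists[OF A] by blast
  then obtain P Q where "similar_mat_wit A T P Q" unfolding similar_mat_def by blast
  from similar_mat_witD2[OF A this]
  have PQ: "P * Q = 1\<^sub>m n" "Q * P = 1\<^sub>m n" and APTQ: "A = P * T * Q"
    and T: "T \<in> carrier_mat n n" and P: "P \<in> carrier_mat n n" and Q: "Q \<in> carrier_mat n n"
    by auto
  define S where "S = {(k, l). k \<le> l \<and> l < n}"
  define U where "U = {(k, l). k < l \<and> l < n}"
  have finS: "finite S" unfolding S_def by (rule finite_subset[of _ "{..<n} \<times> {..<n}"]) auto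
  have finU: "finite U" unfolding U_def by (rule finite_subset[of _ "{..<n} \<times> {..<n}"]) auto
  have finC: "finite C" by (rule finite_subset[OF C(1)]) auto
  \<comment> \<open>Coefficients of the unknown at position \<open>(k, l)\<close>:
    \<open>Inl (i, j)\<close> stands for the entry \<open>(i, j)\<close> of
    \<open>T * Z - Z * T\<close>, and \<open>Inr (i, j)\<close> for that of
    \<open>P * Z * Q\<close>.\<close>
  define c where "c = (\<lambda>e (k, l). case e of
      Inl (i, j) \<Rightarrow> (if l = j then T $$ (i, k) else 0) - (if k = i then T $$ (l, j) else 0)
    | Inr (i, j) \<Rightarrow> P $$ (i, k) * Q $$ (l, j))"
  have "card (U <+> C) < card S"
    using card_strict_upper_add[of n] C finU finC
    by (simp add: card_Plus U_def S_def)
  then obtain z where z: "\<exists>s\<in>S. z s \<noteq> 0" "\<forall>e\<in>U <+> C. (\<Sum>s\<in>S. c e s * z s) = 0"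
    using homogeneous_system_nontrivial[of "U <+> C" S c] finU finC finS by auto
  define Z where "Z = mat n n (\<lambda>(k, l). if k \<le> l then z (k, l) else 0)"
  have Z: "Z \<in> carrier_mat n n" by (simp add: Z_def)
  have sumZ: "(\<Sum>k<n. \<Sum>l<n. g (k, l) * Z $$ (k, l)) = (\<Sum>s\<in>S. g s * z s)" for g
    unfolding sum.cartesian_product
    by (rule sum.mono_neutral_cong_right) (auto simp: S_def Z_def split: if_splits)
  have TZ: "T * Z = Z * T"
  proof (rule eq_matI)
    fix i j assume "i < dim_row (Z * T)" "j < dim_col (Z * T)"
    then have ij: "i < n" "j < n" using T Z by auto
    have TZij: "(T * Z) $$ (i, j) = (\<Sum>k<n. T $$ (i, k) * Z $$ (k, j))"
      and ZTij: "(Z * T) $$ (i, j) = (\<Sum>k<n. Z $$ (i, k) * T $$ (k, j))"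
      using ij T Z by (auto simp: scalar_prod_def lessThan_atLeast0)
    show "(T * Z) $$ (i, j) = (Z * T) $$ (i, j)"
    proof (cases "i < j")
      case True
      then have "Inl (i, j) \<in> U <+> C" using ij by (auto simp: U_def)
      then have "0 = (\<Sum>k<n. \<Sum>l<n. c (Inl (i, j)) (k, l) * Z $$ (k, l))"
        using z(2) sumZ by simp
      also have "\<dots> = (\<Sum>k<n. \<Sum>l<n. if l = j then T $$ (i, k) * Z $$ (k, l) else 0)
          - (\<Sum>k<n. \<Sum>l<n. if k = i then T $$ (l, j) * Z $$ (k, l) else 0)"
        unfolding sum_subtractf[symmetric]
        by (intro sum.cong refl) (simp add: c_def left_diff_distrib)
      also have "(\<Sum>k<n. \<Sum>l<n. if l = j then T $$ (i, k) * Z $$ (k, l) else 0)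
          = (\<Sum>k<n. T $$ (i, k) * Z $$ (k, j))"
        using ij by simp
      also have "(\<Sum>k<n. \<Sum>l<n. if k = i then T $$ (l, j) * Z $$ (k, l) else 0)
          = (\<Sum>l<n. \<Sum>k<n. if k = i then T $$ (l, j) * Z $$ (k, l) else 0)"
        by (rule sum.swap)
      also have "\<dots> = (\<Sum>l<n. Z $$ (i, l) * T $$ (l, j))"
        using ij by (simp add: mult.commute)
      finally show ?thesis unfolding TZij ZTij by simp
    next
      case False
      have T0: "T $$ (k, l) = 0" if "l < k" "k < n" for k l
        using that upT T by (auto simp: upper_triangular_def)
      have Z0: "Z $$ (k, l) = 0" if "l < k" "k < n" for k l
        using that by (auto simp: Z_def)
      \<comment> \<open>On and below the diagonal no equation was imposed. Here triangularity kills
        every term on both sides except possibly \<open>k = i = j\<close>, where the two factors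
        commute as scalars.\<close>
      have "(\<Sum>k<n. T $$ (i, k) * Z $$ (k, j)) = (\<Sum>k<n. Z $$ (i, k) * T $$ (k, j))"
      proof (rule sum.cong[OF refl])
        fix k assume k: "k \<in> {..<n}"
        consider "k < i" | "j < k" | "k = i" "k = j" using False by linarith
        then show "T $$ (i, k) * Z $$ (k, j) = Z $$ (i, k) * T $$ (k, j)"
          using k ij T0 Z0 by cases auto
      qed
      then show ?thesis unfolding TZij ZTij .
    qed
  qed (use T Z in auto)
  \<comment> \<open>Undoing the triangularization turns commuting with \<open>T\<close> into
    commuting with \<open>A\<close>.\<close>
  define Y where "Y = P * Z * Q"
  have Y: "Y \<in> carrier_mat n n" using P Q Z by (simp add: Y_def)
  have conj_mult: "(P * M * Q) * (P * N * Q) = P * (M * N) * Q"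
    if M: "M \<in> carrier_mat n n" and N: "N \<in> carrier_mat n n" for M N
  proof -
    have "(P * M * Q) * (P * N * Q) = P * M * (Q * P) * N * Q"
      using P Q M N by (simp add: assoc_mult_mat[of _ n n _ n _ n])
    also have "\<dots> = P * (M * N) * Q"
      unfolding PQ using P Q M N by (simp add: assoc_mult_mat[of _ n n _ n _ n])
    finally show ?thesis .
  qed
  have "A * Y = Y * A"
    unfolding APTQ Y_def conj_mult[OF T Z] conj_mult[OF Z T] TZ ..
  moreover have "Y \<noteq> 0\<^sub>m n n"
  proof
    assume "Y = 0\<^sub>m n n"
    have "Z = (Q * P) * Z * (Q * P)" unfolding PQ using Z by simp
    also have "\<dots> = Q * Y * P"
      unfolding Y_def using P Q Z by (simp add: assoc_mult_mat[of _ n n _ n _ n])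
    also have "\<dots> = 0\<^sub>m n n" unfolding \<open>Y = 0\<^sub>m n n\<close> using P Q by simp
    finally have Z0: "Z = 0\<^sub>m n n" .
    obtain k l where kl: "k \<le> l" "l < n" "z (k, l) \<noteq> 0" using z(1) by (auto simp: S_def)
    then have "Z $$ (k, l) = z (k, l)" by (simp add: Z_def)
    then show False using Z0 kl by simp
  qed
  moreover have "Y $$ (i, j) = 0" if "(i, j) \<in> C" for i j
  proof -
    have ij: "i < n" "j < n" using that C by auto
    have "Y $$ (i, j) = (\<Sum>l<n. (\<Sum>k<n. P $$ (i, k) * Z $$ (k, l)) * Q $$ (l, j))"
      using ij P Q Z by (simp add: Y_def scalar_prod_def lessThan_atLeast0 del: assoc_mult_mat)
    also have "\<dots> = (\<Sum>l<n. \<Sum>k<n. c (Inr (i, j)) (k, l) * Z $$ (k, l))"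
      by (simp add: c_def sum_distrib_left sum_distrib_right mult_ac)
    also have "\<dots> = (\<Sum>k<n. \<Sum>l<n. c (Inr (i, j)) (k, l) * Z $$ (k, l))"
      by (rule sum.swap)
    also have "\<dots> = 0" unfolding sumZ using z(2) that by auto
    finally show ?thesis .
  qed
  ultimately show ?thesis using Y by auto
qed

text \<open>Triangularization needs the eigenvalues, hence the detour through the complex numbers.
  Since \<open>A\<close> is real, the real and imaginary parts of a complex solution both commute
  with \<open>A\<close> and keep its zeros, and at least one of them is nonzero.\<close>

lemma commuting_matrix_exists:
  fixes A :: "real mat"
  assumes A: "A \<in> carrier_mat n n" and C: "C \<subseteq> {..<n} \<times> {..<n}" "card C < n"
  shows "\<exists>Y \<in> carrier_mat n n. Y \<noteq> 0\<^sub>m n n \<and> A * Y = Y * A \<and> (\<forall>(i, j)\<in>C. Y $$ (i, j) = 0)"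
proof -
  define Ac where "Ac = map_mat complex_of_real A"
  have "Ac \<in> carrier_mat n n" using A by (simp add: Ac_def)
  then obtain Y where Y: "Y \<in> carrier_mat n n" "Y \<noteq> 0\<^sub>m n n" and comm: "Ac * Y = Y * Ac"
    and YC: "\<forall>(i, j)\<in>C. Y $$ (i, j) = 0"
    using complex_commuting_matrix_exists[OF _ C] by blast
  \<comment> \<open>The assumptions on \<open>h\<close> are real linearity, so that
    \<open>Re\<close> and \<open>Im\<close> are treated at once.\<close>
  have part: "A * map_mat h Y = map_mat h Y * A"
    if add: "\<And>x y. h (x + y) = h x + h y" and h0: "h 0 = 0"
      and scale: "\<And>r x. h (complex_of_real r * x) = r * h x" for h :: "complex \<Rightarrow> real"
  proof (rule eq_matI)
    fix i j assume "i < dim_row (map_mat h Y * A)" "j < dim_col (map_mat h Y * A)"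
    then have ij: "i < n" "j < n" using A Y by auto
    have h_sum: "h (\<Sum>k\<in>K. f k) = (\<Sum>k\<in>K. h (f k))" for f :: "nat \<Rightarrow> complex" and K
      by (induction K rule: infinite_finite_induct) (simp_all add: add h0)
    have scale': "h (x * complex_of_real r) = h x * r" for r x
      using scale[of r x] by (simp add: mult.commute)
    have "h ((Ac * Y) $$ (i, j)) = h ((Y * Ac) $$ (i, j))" using comm by simp
    moreover have "h ((Ac * Y) $$ (i, j)) = (A * map_mat h Y) $$ (i, j)"
      using ij A Y by (simp add: Ac_def scalar_prod_def h_sum scale)
    moreover have "h ((Y * Ac) $$ (i, j)) = (map_mat h Y * A) $$ (i, j)"
      using ij A Y by (simp add: Ac_def scalar_prod_def h_sum scale')
    ultimately show "(A * map_mat h Y) $$ (i, j) = (map_mat h Y * A) $$ (i, j)" by simp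
  qed (use A Y in auto)
  obtain i j where ij: "i < n" "j < n" "Y $$ (i, j) \<noteq> 0"
    using Y by (metis carrier_matD eq_matI index_zero_mat)
  obtain h where h: "h = Re \<or> h = Im" and hij: "h (Y $$ (i, j)) \<noteq> 0"
    using ij(3) by (metis complex_eqI zero_complex.simps)
  have "A * map_mat h Y = map_mat h Y * A"
    using h by (intro part) auto
  moreover have "map_mat h Y \<noteq> 0\<^sub>m n n"
    using hij ij Y by (metis carrier_matD index_map_mat(1) index_zero_mat(1))
  moreover have "map_mat h Y $$ (k, l) = 0" if "(k, l) \<in> C" for k l
    using that C YC h Y by (auto simp: subset_iff)
  moreover have "map_mat h Y \<in> carrier_mat n n" using Y by simp
  ultimately show ?thesis by auto
qed

section \<open>Circulations and parent functions on trees\<close>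

text \<open>Read \<open>f u w\<close> as the flow from \<open>u\<close> to \<open>w\<close>. By
  conservation, positive flow into a vertex continues out of it; following it in a finite graph
  closes a directed cycle. Antisymmetry forces this cycle to have length at least 3.\<close>

lemma forest_circulation_eq_0:
  fixes f :: "'a \<Rightarrow> 'a \<Rightarrow> real"
  assumes H: "pair_graph H"
    and acyclic: "\<not> (\<exists>p. pre_digraph.cycle (with_proj H) p \<and> 3 \<le> length p)"
    and supp: "\<And>u w. u \<in> pverts H \<Longrightarrow> w \<in> pverts H \<Longrightarrow> f u w \<noteq> 0 \<Longrightarrow> (u, w) \<in> parcs H"
    and antisym: "\<And>u w. f u w = - f w u"
    and div0: "\<And>u. u \<in> pverts H \<Longrightarrow> (\<Sum>w\<in>pverts H. f u w) = 0"
    and uw: "u \<in> pverts H" "w \<in> pverts H"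
  shows "f u w = 0"
proof (rule ccontr)
  assume nz: "f u w \<noteq> 0"
  interpret H: pair_graph H by fact
  define R where "R = {(x, y). x \<in> pverts H \<and> y \<in> pverts H \<and> f x y > 0}"
  define D where "D = \<lparr>pverts = pverts H, parcs = R\<rparr>"
  interpret D: pair_wf_digraph D by unfold_locales (auto simp: D_def R_def)
  have succ: "\<exists>z. (y, z) \<in> R" if "(x, y) \<in> R" for x y
  proof (rule ccontr)
    assume "\<not> ?thesis"
    then have "f y z \<le> 0" if "z \<in> pverts H" for z
      using that \<open>(x, y) \<in> R\<close> by (auto simp: R_def not_less)
    moreover have "f y x < 0" using that antisym[of y x] by (auto simp: R_def)
    ultimately have "(\<Sum>z\<in>pverts H. f y z) < (\<Sum>z\<in>pverts H. 0)"
      using that by (intro sum_strict_mono_ex1) (auto simp: R_def)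
    then show False using div0[of y] that by (auto simp: R_def)
  qed
  have "\<not> acyclic R"
  proof
    assume "acyclic R"
    moreover have "finite R"
      by (rule finite_subset[of _ "pverts H \<times> pverts H"]) (auto simp: R_def)
    \<comment> \<open>Without cycles, some vertex of \<open>Range R\<close> would have no successor
      in \<open>Range R\<close>, against \<open>succ\<close>.\<close>
    ultimately have "wf (R\<inverse>)" by (rule finite_acyclic_wf_converse[rotated])
    moreover have "(u, w) \<in> R \<or> (w, u) \<in> R"
      using nz antisym[of u w] uw by (auto simp: R_def)
    then have "Range R \<noteq> {}" by blast
    ultimately obtain y where "y \<in> Range R" "\<And>z. (z, y) \<in> R\<inverse> \<Longrightarrow> z \<notin> Range R"
      by (metis wfE_min ex_in_conv)
    then show False using succ by blast
  qed
  then obtain x where "(x, x) \<in> R\<^sup>+" by (auto simp: acyclic_def)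
  then have "(x, x) \<in> (parcs D)\<^sup>+" by (simp add: D_def)
  then obtain q where "D.awalk x q x" "q \<noteq> []" using D.reachable1_awalk by blast
  then have "D.closed_w q" by (auto simp: D.closed_w_def)
  then obtain p where p: "D.cycle p" using D.closed_w_imp_cycle by blast
  have "subgraph (with_proj D) (with_proj H)"
    using supp H.wf_digraph_axioms D.wf_digraph_axioms
    by (auto simp: subgraph_def compatible_def D_def R_def)
  then have "H.cycle p" using p by (rule H.subgraph_cycle)
  \<comment> \<open>Length 1 would make \<open>f v v\<close> positive, and length 2 would make the
    flow positive in both directions of an edge.\<close>
  moreover have "3 \<le> length p"
  proof (rule ccontr)
    assume "\<not> 3 \<le> length p"
    obtain v where v: "D.awalk v p v" "p \<noteq> []" using p by (auto simp: D.cycle_def)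
    then have pR: "set p \<subseteq> R" "pcas v p v" unfolding D.awalk_def by (simp_all add: D_def)
    from \<open>\<not> 3 \<le> length p\<close> v(2) consider a where "p = [a]" | a b where "p = [a, b]"
      by (cases p; cases "tl p"; cases "tl (tl p)") auto
    then show False
    proof cases
      case 1
      then have "f v v > 0" using pR by (auto simp: R_def)
      then show False using antisym[of v v] by simp
    next
      case 2
      then have "f v (snd a) > 0" "f (snd a) v > 0"
        using pR by (auto simp: R_def)
      then show False using antisym[of v "snd a"] by simp
    qed
  qed
  ultimately show False using acyclic by blast
qed

text \<open>Breadth-first search: \<open>d\<close> is the distance from a root \<open>r\<close>, and
  \<open>p v\<close> precedes \<open>v\<close> on a shortest path from \<open>r\<close>. The
  decrease of \<open>d\<close> prevents two vertices from being each other's parent, so different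
  \<open>v\<close> give different edges.\<close>

lemma connected_parent_function:
  assumes H: "pair_graph H" and conn: "connected (with_proj H)"
  obtains r and p :: "'a \<Rightarrow> 'a" and d :: "'a \<Rightarrow> nat" where "r \<in> pverts H"
    "\<And>v. v \<in> pverts H - {r} \<Longrightarrow> (p v, v) \<in> parcs H \<and> d (p v) < d v"
proof -
  interpret H: pair_graph H by fact
  have sc: "strongly_connected (with_proj H)"
    using H.symmetric_connected_imp_strongly_connected[OF H.pair_sym_arcs conn] .
  then obtain r where r: "r \<in> pverts H" by (auto simp: strongly_connected_def)
  define d where "d = (\<lambda>v. LEAST k. (r, v) \<in> parcs H ^^ k)"
  have "\<exists>x. (x, v) \<in> parcs H \<and> d x < d v" if v: "v \<in> pverts H - {r}" for v
  proof -
    have "(r, v) \<in> (parcs H)\<^sup>*"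
      using sc r v reachable_rtranclI[of "with_proj H" r v] by (auto simp: strongly_connected_def)
    then obtain k where "(r, v) \<in> parcs H ^^ k" by (auto simp: rtrancl_power)
    then have "(r, v) \<in> parcs H ^^ d v" unfolding d_def by (rule LeastI)
    \<comment> \<open>The distance is not 0 because \<open>v\<close> differs from
      \<open>r\<close>.\<close>
    moreover obtain m where m: "d v = Suc m" using calculation v by (cases "d v") auto
    ultimately obtain x where "(r, x) \<in> parcs H ^^ m" "(x, v) \<in> parcs H" by auto
    moreover from this(1) have "d x \<le> m" unfolding d_def by (rule Least_le)
    ultimately show ?thesis using m by auto
  qed
  then obtain p where "\<And>v. v \<in> pverts H - {r} \<Longrightarrow> (p v, v) \<in> parcs H \<and> d (p v) < d v"
    by metis
  then show ?thesis using that r by blast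
qed

section \<open>The two cases of the theorem\<close>

lemma one_loop_no_nSSP:
  assumes G: "digraph_on n G" and n: "n \<ge> 2" and nd: "\<not> has_double_arc G"
    and loop: "\<exists>!v. (v, v) \<in> parcs G" and AG: "A \<in> matrices_of G"
  shows "\<not> has_nSSP A"
proof -
  interpret pair_wf_digraph G using G by (simp add: digraph_on_def)
  have V: "pverts G = {0..<n}" using G by (simp add: digraph_on_def)
  have A: "A \<in> carrier_mat n n" and entry: "\<And>i j. i < n \<Longrightarrow> j < n \<Longrightarrow> A $$ (i, j) \<noteq> 0 \<longleftrightarrow> (i, j) \<in> parcs G"
    using AG by (auto simp: matrices_of_def V)
  obtain v where v: "(v, v) \<in> parcs G" and uniq: "\<And>w. (w, w) \<in> parcs G \<Longrightarrow> w = v"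
    using loop by auto
  have vn: "v < n" using in_arcsD1[OF v] V by simp
  \<comment> \<open>A second vertex carries no loop, so the diagonal entry of \<open>Y\<close> there
    is \<open>- A $$ (v, v)\<close>, which is nonzero.\<close>
  obtain i where i: "i < n" "i \<noteq> v" using n by (cases "v = 0") (auto intro: that[of 0] that[of 1])
  define Y where "Y = A - A $$ (v, v) \<cdot>\<^sub>m 1\<^sub>m n"
  have Y: "Y \<in> carrier_mat n n" using A unfolding Y_def by (intro minus_carrier_mat) auto
  define X where "X = transpose_mat Y"
  have X: "X \<in> carrier_mat n n" "transpose_mat X = Y" using Y by (auto simp: X_def)
  have "A * Y = Y * A"
    unfolding Y_def using A
    by (simp add: mult_minus_distrib_mat[of _ n n _ n] minus_mult_distrib_mat[of _ n n _ _ n]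
        mult_smult_distrib[of _ n n _ n] mult_smult_assoc_mat[of _ n n _ n])
  then have "A * transpose_mat X - transpose_mat X * A = 0\<^sub>m n n"
    using A Y X by auto
  moreover have "hadamard A X = 0\<^sub>m n n"
  proof (rule eq_matI)
    fix k l assume "k < dim_row (0\<^sub>m n n :: real mat)" "l < dim_col (0\<^sub>m n n :: real mat)"
    then have kl: "k < n" "l < n" by auto
    \<comment> \<open>Off the diagonal \<open>Y\<close> agrees with \<open>A\<close>, so the
      Hadamard entry is \<open>A $$ (k, l) * A $$ (l, k)\<close>. On the diagonal, \<open>A\<close>
      vanishes except at \<open>v\<close>, and there \<open>Y\<close> vanishes.\<close>
    have "A $$ (k, l) = 0 \<or> A $$ (l, k) = 0" if "k \<noteq> l"
      using that nd entry kl by (auto simp: has_double_arc_def)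
    moreover have "A $$ (k, k) = 0 \<or> k = v" using entry kl uniq by blast
    ultimately show "hadamard A X $$ (k, l) = 0\<^sub>m n n $$ (k, l)"
      using kl A by (auto simp: hadamard_def X_def Y_def)
  qed (use A in \<open>auto simp: hadamard_def\<close>)
  moreover have "X \<noteq> 0\<^sub>m n n"
  proof
    assume "X = 0\<^sub>m n n"
    then have "X $$ (i, i) = 0" using i by simp
    moreover have "A $$ (i, i) = 0" using entry i uniq by blast
    moreover have "A $$ (v, v) \<noteq> 0" using entry vn v by blast
    ultimately show False using i A by (simp add: X_def Y_def)
  qed
  ultimately show ?thesis using A X(1) by (auto simp: has_nSSP_def)
qed

lemma sparse_tree_no_nSSP:
  assumes G: "digraph_on n G" and size: "int (card (parcs G)) \<le> 2 * int n - 2"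
    and tree: "undirected_tree (underlying_simple_graph G)" and AG: "A \<in> matrices_of G"
  shows "\<not> has_nSSP A"
proof -
  interpret pair_wf_digraph G using G by (simp add: digraph_on_def)
  have V: "pverts G = {..<n}" using G by (auto simp: digraph_on_def)
  have A: "A \<in> carrier_mat n n"
    and entry: "\<And>i j. i < n \<Longrightarrow> j < n \<Longrightarrow> A $$ (i, j) \<noteq> 0 \<longleftrightarrow> (i, j) \<in> parcs G"
    using AG by (auto simp: matrices_of_def V)
  have arcs: "parcs G \<subseteq> {..<n} \<times> {..<n}" using V by (auto dest: wellformed')
  then have fin: "finite (parcs G)" by (rule finite_subset) simp
  define H where "H = underlying_simple_graph G"
  have H: "pair_graph H" using pair_graph_underlying_simple_graph[OF G] by (simp add: H_def)
  have VH: "pverts H = {..<n}" by (simp add: H_def underlying_simple_graph_def V)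
  have arcsH: "(u, w) \<in> parcs H \<longleftrightarrow> u \<noteq> w \<and> ((u, w) \<in> parcs G \<or> (w, u) \<in> parcs G)" for u w
    by (simp add: H_def underlying_simple_graph_def)
  have conn: "connected (with_proj H)"
    and acyclic: "\<not> (\<exists>p. pre_digraph.cycle (with_proj H) p \<and> 3 \<le> length p)"
    using tree by (auto simp: undirected_tree_def H_def)
  obtain r p and d :: "nat \<Rightarrow> nat" where "r \<in> pverts H"
    and "\<And>v. v \<in> pverts H - {r} \<Longrightarrow> (p v, v) \<in> parcs H \<and> d (p v) < d v"
    by (rule connected_parent_function[OF H conn]) blast
  then have r: "r < n"
    and parent: "\<And>v. v \<in> {..<n} - {r} \<Longrightarrow> (p v, v) \<in> parcs H \<and> d (p v) < d v"
    by (simp_all add: VH)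
  \<comment> \<open>\<open>g v\<close> selects one arc of \<open>G\<close> on the tree edge between
    \<open>v\<close> and its parent; the condition belonging to this arc will be dropped.\<close>
  define g where "g = (\<lambda>v. if (p v, v) \<in> parcs G then (p v, v) else (v, p v))"
  have g_arc: "g v \<in> parcs G" if "v \<in> {..<n} - {r}" for v
    using parent[OF that] by (auto simp: g_def arcsH)
  \<comment> \<open>Agreement up to orientation with \<open>v\<close> and \<open>v'\<close>
    different would make each the parent of the other, which \<open>d\<close> excludes. The swapped
    form also shows that no selected arc has its opposite selected.\<close>
  have g_eqD: "v = v'"
    if "v \<in> {..<n} - {r}" "v' \<in> {..<n} - {r}" "g v = g v' \<or> g v = prod.swap (g v')" for v v'
    using parent[OF that(1)] parent[OF that(2)] that(3)
    by (auto simp: g_def split: if_splits)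
  have "inj_on g ({..<n} - {r})" using g_eqD by (auto intro!: inj_onI)
  then have "card (g ` ({..<n} - {r})) = n - 1" using r by (simp add: card_image)
  moreover have "g ` ({..<n} - {r}) \<subseteq> parcs G" using g_arc by (rule image_subsetI)
  ultimately have cardC: "card (parcs G - g ` ({..<n} - {r})) < n"
    using size r by (subst card_Diff_subset) (auto intro: finite_subset)
  \<comment> \<open>The converse appears because an arc \<open>(i, j)\<close> demands a zero of
    \<open>Y\<close> at \<open>(j, i)\<close>.\<close>
  define C where "C = (parcs G - g ` ({..<n} - {r}))\<inverse>"
  have "C \<subseteq> {..<n} \<times> {..<n}" "card C < n" using arcs cardC by (auto simp: C_def)
  from commuting_matrix_exists[OF A this]
  obtain Y where Y: "Y \<in> carrier_mat n n" "Y \<noteq> 0\<^sub>m n n" and comm: "A * Y = Y * A"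
    and "\<forall>(i, j)\<in>C. Y $$ (i, j) = 0"
    by blast
  then have YC: "Y $$ (i, j) = 0" if "(i, j) \<in> C" for i j using that by blast
  define f where "f = (\<lambda>u w. A $$ (u, w) * Y $$ (w, u) - A $$ (w, u) * Y $$ (u, w))"
  have f0: "f u w = 0" if "u < n" "w < n" for u w
  proof (rule forest_circulation_eq_0[OF H acyclic])
    show "f u w = - f w u" for u w by (simp add: f_def)
    show "(u, w) \<in> parcs H" if "u \<in> pverts H" "w \<in> pverts H" "f u w \<noteq> 0" for u w
      using that entry[of u w] entry[of w u] unfolding arcsH VH f_def by auto
    show "(\<Sum>w\<in>pverts H. f u w) = 0" if "u \<in> pverts H" for u
    proof -
      have "(\<Sum>w<n. f u w) = (A * Y) $$ (u, u) - (Y * A) $$ (u, u)"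
        using that A Y
        by (simp add: VH f_def sum_subtractf scalar_prod_def lessThan_atLeast0 mult.commute)
      then show ?thesis unfolding comm VH by simp
    qed
  qed (use that VH in auto)
  have Y0: "Y $$ (j, i) = 0" if ij: "(i, j) \<in> parcs G" for i j
  proof (cases "(j, i) \<in> C")
    case False
    have n: "i < n" "j < n" using ij arcs by auto
    from False ij obtain v where v: "v \<in> {..<n} - {r}" "(i, j) = g v" by (auto simp: C_def)
    have "i \<noteq> j" using v parent[OF v(1)] by (auto simp: g_def split: if_splits)
    \<comment> \<open>For a selected arc \<open>(i, j)\<close>, the opposite pair either is no arc,
      so that \<open>A $$ (j, i)\<close> is 0, or is an unselected arc, whose condition was kept.
      Then \<open>f i j = 0\<close> leaves \<open>A $$ (i, j) * Y $$ (j, i) = 0\<close>, which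
      recovers the dropped condition.\<close>
    have "A $$ (j, i) * Y $$ (i, j) = 0"
    proof (cases "(j, i) \<in> parcs G")
      case True
      have "(j, i) \<noteq> g v'" if "v' \<in> {..<n} - {r}" for v'
        using g_eqD[OF v(1) that] v(2) \<open>i \<noteq> j\<close> by (metis prod.inject swap_simp)
      then have "(i, j) \<in> C" using True by (auto simp: C_def)
      then show ?thesis using YC by simp
    qed (use entry n in auto)
    then have "A $$ (i, j) * Y $$ (j, i) = 0" using f0[OF n] by (simp add: f_def)
    then show ?thesis using entry[OF n] ij by simp
  qed (use YC in blast)
  define X where "X = transpose_mat Y"
  have X: "X \<in> carrier_mat n n" "transpose_mat X = Y" using Y by (auto simp: X_def)
  have "A * transpose_mat X - transpose_mat X * A = 0\<^sub>m n n"
    unfolding X comm using A Y by auto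
  moreover have "hadamard A X = 0\<^sub>m n n"
  proof (rule eq_matI)
    fix i j assume "i < dim_row (0\<^sub>m n n :: real mat)" "j < dim_col (0\<^sub>m n n :: real mat)"
    then show "hadamard A X $$ (i, j) = 0\<^sub>m n n $$ (i, j)"
      using A Y Y0 entry[of i j] by (auto simp: hadamard_def X_def)
  qed (use A in \<open>auto simp: hadamard_def\<close>)
  moreover have "X \<noteq> 0\<^sub>m n n" using X Y by auto
  ultimately show ?thesis using A X(1) by (auto simp: has_nSSP_def)
qed

theorem theorem2p7:
  fixes n :: nat and G :: "nat pair_pre_digraph"
  assumes "digraph_on n G"
    and "(n \<ge> 2 \<and> \<not> has_double_arc G \<and> (\<exists>!v. (v, v) \<in> parcs G)) \<or>
         (int (card (parcs G)) \<le> 2 * int n - 2 \<and> undirected_tree (underlying_simple_graph G))"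
  shows "\<not> allows_nSSP G"
  unfolding allows_nSSP_def using assms one_loop_no_nSSP sparse_tree_no_nSSP by blast

end
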